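(* Let $C_0,C_1,C_2,C_3>0$ with $C_3\le C_0$ and $C_3<C_1+C_2$, and let $\beta,\xi\in[0,1]$. (a) If $\xi\in\Xi_1$, the Poincaré map $F$ (its branch for $\Xi_1$) is finite-time stable at: (i) $v^*=C_1$ when $\frac{C_1}{C_3}\le\xi\le1$; (ii) $v^*=\xi C_3$ when $\xi\in\left(1-\frac{C_2}{C_3},\frac{C_1}{C_3}\right)$ and $\xi=\beta$; (iii) $v^*=\xi C_3$ when $C_3=C_0$, $\xi\in\left(1-\frac{C_2}{C_3},\frac{C_1}{C_3}\right)$ and $\xi>\beta$. (b) If $\xi\in\Xi_2$, the Poincaré map $F$ (its branch for $\Xi_2$) is finite-time stable at: (i) $v^*=C_3-C_2$ when $0\le\xi\le1-\frac{C_2}{C_3}$; (ii) $v^*=\xi C_3$ when $C_3=C_0$, $\xi\in\left(1-\frac{C_2}{C_3},\frac{C_1}{C_3}\right)$ and $\xi<\beta$.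
   Context: The setting is a diverge-merge (DM) traffic network: upstream link 0, two parallel intermediate links 1 and 2, and downstream link 3. $C_a>0$ is the capacity of link $a$; $\beta$ is the merging ratio of link 1; $\xi$ is the constant proportion of vehicles choosing link 1. For $C_3\le C_0$ and $C_3<C_1+C_2$, let $\Xi_1$ be the set of $\xi\in[0,1]$ such that either $\frac{C_1}{C_3}\le\xi\le1$, or $1-\frac{C_2}{C_3}<\xi<\frac{C_1}{C_3}$ and $\xi\ge\beta$. Let $\Xi_2$ be the set of $\xi\in[0,1]$ such that either $0\le\xi\le1-\frac{C_2}{C_3}$, or $1-\frac{C_2}{C_3}<\xi<\frac{C_1}{C_3}$ and $\xi\le\beta$. It is assumed that $\xi>0$ when $\xi\in\Xi_1$ is considered and $\xi<1$ when $\xi\in\Xi_2$ is considered, so that the formulas below make sense. Put $$A_1=\max\{C_3-(1-\xi)C_0,\;C_3-C_2,\;\beta C_3\},\qquad A_2'=\min\{\xi C_0,\;C_1,\;\beta C_3\}.$$ The Poincaré map $F$ is the one-dimensional map $$Fv=\begin{cases}\min\{C_1,\max\{A_1,\,C_3-\frac{1-\xi}{\xi}v\}\}, & \xi\in\Xi_1,\\ \max\{C_3-C_2,\min\{A_2',\,\frac{\xi}{1-\xi}(C_3-v)\}\}, & \xi\in\Xi_2.\end{cases}$$ In the branch $\xi\in\Xi_1$, $v$ is the out-flux of link 1, so $v\in[0,C_1]$; in the branch $\xi\in\Xi_2$, $C_3-v$ is the out-flux of link 2, so $v\in[C_3-C_2,C_3]$. A fixed point $v^*$ of $F$ is finite-time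 stable (and $F$ is finite-time stable at $v^*$) if and only if the discrete dynamical system given by iterating $F$, starting from any initial condition $v$ in the domain, converges to $v^*$ in a finite number of time-steps, i.e. $F^nv=v^*$ for some finite $n$ and all later iterates. *)

theory Defs
  imports Complex_Main
begin

text \<open>
  In a diverge-merge network, link 0 is upstream, links 1 and 2 are parallel, and link 3 is
  downstream; \<open>Ca\<close> is the capacity of link \<open>a\<close>, \<open>\<beta>\<close> the merging ratio of link 1, and \<open>\<xi>\<close> the
  proportion of vehicles choosing link 1.
\<close>

definition Xi1 :: "real \<Rightarrow> real \<Rightarrow> real \<Rightarrow> real \<Rightarrow> real set" where
  "Xi1 C1 C2 C3 \<beta> =
    {\<xi>\<in>{0..1}. (C1 / C3 \<le> \<xi> \<and> \<xi> \<le> 1) \<or> (1 - C2 / C3 < \<xi> \<and> \<xi> < C1 / C3 \<and> \<xi> \<ge> \<beta>)}"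

definition Xi2 :: "real \<Rightarrow> real \<Rightarrow> real \<Rightarrow> real \<Rightarrow> real set" where
  "Xi2 C1 C2 C3 \<beta> =
    {\<xi>\<in>{0..1}. (0 \<le> \<xi> \<and> \<xi> \<le> 1 - C2 / C3) \<or> (1 - C2 / C3 < \<xi> \<and> \<xi> < C1 / C3 \<and> \<xi> \<le> \<beta>)}"

definition A1 :: "real \<Rightarrow> real \<Rightarrow> real \<Rightarrow> real \<Rightarrow> real \<Rightarrow> real" where
  "A1 C0 C2 C3 \<beta> \<xi> = max (C3 - (1 - \<xi>) * C0) (max (C3 - C2) (\<beta> * C3))"

definition A2' :: "real \<Rightarrow> real \<Rightarrow> real \<Rightarrow> real \<Rightarrow> real \<Rightarrow> real" where
  "A2' C0 C1 C3 \<beta> \<xi> = min (\<xi> * C0) (min C1 (\<beta> * C3))"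

text \<open>
  \<open>Xi1\<close> and \<open>Xi2\<close> overlap at \<open>\<xi> = \<beta>\<close>, and the state \<open>v\<close> has a different meaning
  (hence a different domain) on each, so the two branches of the map are separate functions:
  in the first, \<open>v\<close> is the out-flux of link 1; in the second, \<open>C3 - v\<close> is the out-flux of link 2.
  The formulas are meaningful only for \<open>\<xi> > 0\<close> and \<open>\<xi> < 1\<close>, respectively.
\<close>

definition poincare1 :: "real \<Rightarrow> real \<Rightarrow> real \<Rightarrow> real \<Rightarrow> real \<Rightarrow> real \<Rightarrow> real \<Rightarrow> real" where
  "poincare1 C0 C1 C2 C3 \<beta> \<xi> v =
    min C1 (max (A1 C0 C2 C3 \<beta> \<xi>) (C3 - (1 - \<xi>) / \<xi> * v))"

definition poincare2 :: "real \<Rightarrow> real \<Rightarrow> real \<Rightarrow> real \<Rightarrow> real \<Rightarrow> real \<Rightarrow> real \<Rightarrow> real" where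
  "poincare2 C0 C1 C2 C3 \<beta> \<xi> v =
    max (C3 - C2) (min (A2' C0 C1 C3 \<beta> \<xi>) (\<xi> / (1 - \<xi>) * (C3 - v)))"

definition finite_time_stable_at :: "'a set \<Rightarrow> ('a \<Rightarrow> 'a) \<Rightarrow> 'a \<Rightarrow> bool" where
  "finite_time_stable_at D F p \<longleftrightarrow>
    p \<in> D \<and> F p = p \<and> (\<forall>v\<in>D. \<exists>n. \<forall>m\<ge>n. (F ^^ m) v = p)"

end

theory Submission
  imports Defs
begin

text \<open>
  In cases (i) of both parts the outer \<open>min\<close> (resp. \<open>max\<close>) is active on the whole domain, so
  the map is constant. In the remaining cases \<open>A1\<close> (resp. \<open>A2'\<close>) equals \<open>\<xi> * C3\<close>, the fixed
  point of the decreasing affine part. Every value of the map then lies on one side of \<open>\<xi> * C3\<close>,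
  and points on that side are sent to \<open>\<xi> * C3\<close>. Hence two steps always suffice.
\<close>

text \<open>The witness \<open>n = 2\<close> serves every start: once an orbit has reached
  \<open>p\<close>, fixedness keeps it there.\<close>

lemma finite_time_stable_at_two_steps:
  assumes "p \<in> D" and "F p = p" and "\<And>v. v \<in> D \<Longrightarrow> F (F v) = p"
  shows "finite_time_stable_at D F p"
proof -
  have iterate: "(F ^^ k) p = p" for k
    using assms(2) by (induction k) auto
  have "(F ^^ m) v = p" if "v \<in> D" and "m \<ge> 2" for v m
  proof -
    have "(F ^^ m) v = (F ^^ (m - 2)) ((F ^^ 2) v)"
      using that(2) by (metis comp_apply funpow_add le_add_diff_inverse2)
    also have "(F ^^ 2) v = p"
      using assms(3)[OF that(1)] by (simp add: numeral_2_eq_2)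
    finally show ?thesis
      by (simp add: iterate)
  qed
  then show ?thesis
    using assms(1,2) unfolding finite_time_stable_at_def by blast
qed

text \<open>Here \<open>v \<le> C1 \<le> \<xi> * C3\<close>, so the decreasing affine term is at
  least its value \<open>\<xi> * C3\<close> at its own fixed point, hence at least the cap
  \<open>C1\<close>.\<close>

lemma poincare1_eq_C1:
  assumes "C3 > 0" and "C1 / C3 \<le> \<xi>" and "\<xi> > 0" and "\<xi> \<le> 1" and "v \<le> C1"
  shows "poincare1 C0 C1 C2 C3 \<beta> \<xi> v = C1"
proof -
  have C1: "C1 \<le> \<xi> * C3"
    using assms(1,2) by (simp add: field_simps)
  have "(1 - \<xi>) / \<xi> * v \<le> (1 - \<xi>) / \<xi> * (\<xi> * C3)"
    using assms(3-5) C1 by (intro mult_left_mono) auto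
  also have "\<dots> = C3 - \<xi> * C3"
    using assms(3) by (simp add: field_simps)
  finally show ?thesis
    using C1 unfolding poincare1_def by linarith
qed

text \<open>The cases \<open>\<xi> = \<beta>\<close> and \<open>C3 = C0\<close> differ only in which
  entry of \<open>A1\<close> attains \<open>\<xi> * C3\<close>, so that value is taken as a
  hypothesis.\<close>

lemma finite_time_stable_poincare1:
  assumes "0 < \<xi>" and "\<xi> \<le> 1" and "0 \<le> C3" and "\<xi> * C3 < C1"
    and A1: "A1 C0 C2 C3 \<beta> \<xi> = \<xi> * C3"
  shows "finite_time_stable_at {0..C1} (poincare1 C0 C1 C2 C3 \<beta> \<xi>) (\<xi> * C3)"
proof (rule finite_time_stable_at_two_steps)
  let ?F = "poincare1 C0 C1 C2 C3 \<beta> \<xi>"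
  have F_above: "?F v = \<xi> * C3" if "\<xi> * C3 \<le> v" for v
  proof -
    \<comment> \<open>The affine term fixes \<open>\<xi> * C3\<close>; to the right of that point it
      drops below the floor \<open>A1\<close>, which then determines the value.\<close>
    have "C3 - \<xi> * C3 = (1 - \<xi>) / \<xi> * (\<xi> * C3)"
      using assms(1) by (simp add: field_simps)
    also have "\<dots> \<le> (1 - \<xi>) / \<xi> * v"
      using assms(1,2) that by (intro mult_left_mono) auto
    finally show ?thesis
      using assms(4) unfolding poincare1_def A1 by linarith
  qed
  have "\<xi> * C3 \<le> ?F v" for v
    using assms(4) unfolding poincare1_def A1 by linarith
  then show "?F (?F v) = \<xi> * C3" for v
    by (rule F_above)
  show "?F (\<xi> * C3) = \<xi> * C3"
    by (rule F_above) simp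
  show "\<xi> * C3 \<in> {0..C1}"
    using assms(1,3,4) by simp
qed

text \<open>Exchanging links 1 and 2, that is \<open>v\<close> with \<open>C3 - v\<close>,
  \<open>\<xi>\<close> with \<open>1 - \<xi>\<close>, \<open>\<beta>\<close> with
  \<open>1 - \<beta>\<close> and \<open>C1\<close> with \<open>C2\<close>, turns
  \<open>poincare1\<close> into \<open>poincare2\<close>. The argument mirrors the one for the cap
  \<open>C1\<close>, now with \<open>C3 - v \<le> C2 \<le> (1 - \<xi>) * C3\<close>.\<close>

lemma poincare2_eq_C3_minus_C2:
  assumes "C3 > 0" and "0 \<le> \<xi>" and "\<xi> < 1" and "\<xi> \<le> 1 - C2 / C3" and "C3 - C2 \<le> v"
  shows "poincare2 C0 C1 C2 C3 \<beta> \<xi> v = C3 - C2"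
proof -
  have C2: "C2 \<le> (1 - \<xi>) * C3"
    using assms(1,4) by (simp add: field_simps)
  have "\<xi> / (1 - \<xi>) * (C3 - v) \<le> \<xi> / (1 - \<xi>) * ((1 - \<xi>) * C3)"
    using assms(2,3,5) C2 by (intro mult_left_mono) auto
  also have "\<dots> = C3 - (1 - \<xi>) * C3"
    using assms(3) by (simp add: field_simps)
  finally show ?thesis
    using C2 unfolding poincare2_def by linarith
qed

text \<open>Under the same exchange the floor \<open>A1\<close> becomes the ceiling
  \<open>A2'\<close>, and the values of the map lie to the left of
  \<open>\<xi> * C3\<close>.\<close>

lemma finite_time_stable_poincare2:
  assumes "0 \<le> \<xi>" and "\<xi> < 1" and "0 \<le> C3" and "C3 - C2 < \<xi> * C3"
    and A2: "A2' C0 C1 C3 \<beta> \<xi> = \<xi> * C3"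
  shows "finite_time_stable_at {C3 - C2..C3} (poincare2 C0 C1 C2 C3 \<beta> \<xi>) (\<xi> * C3)"
proof (rule finite_time_stable_at_two_steps)
  let ?F = "poincare2 C0 C1 C2 C3 \<beta> \<xi>"
  have F_below: "?F v = \<xi> * C3" if "v \<le> \<xi> * C3" for v
  proof -
    have "\<xi> * C3 = \<xi> / (1 - \<xi>) * (C3 - \<xi> * C3)"
      using assms(2) by (simp add: field_simps)
    also have "\<dots> \<le> \<xi> / (1 - \<xi>) * (C3 - v)"
      using assms(1,2) that by (intro mult_left_mono) auto
    finally show ?thesis
      using assms(4) unfolding poincare2_def A2 by linarith
  qed
  have "?F v \<le> \<xi> * C3" for v
    using assms(4) unfolding poincare2_def A2 by linarith
  then show "?F (?F v) = \<xi> * C3" for v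
    by (rule F_below)
  show "?F (\<xi> * C3) = \<xi> * C3"
    by (rule F_below) simp
  show "\<xi> * C3 \<in> {C3 - C2..C3}"
    using assms(2-4) mult_right_mono[of \<xi> 1 C3] by simp
qed

theorem theorem3p2:
  fixes C0 C1 C2 C3 \<beta> \<xi> :: real
  assumes "C0 > 0" and "C1 > 0" and "C2 > 0" and "C3 > 0"
    and "C3 \<le> C0" and "C3 < C1 + C2"
    and "\<beta> \<in> {0..1}" and "\<xi> \<in> {0..1}"
  shows
    "(\<xi> \<in> Xi1 C1 C2 C3 \<beta> \<and> \<xi> > 0 \<longrightarrow>
        (C1 / C3 \<le> \<xi> \<and> \<xi> \<le> 1 \<longrightarrow>
          finite_time_stable_at {0..C1} (poincare1 C0 C1 C2 C3 \<beta> \<xi>) C1) \<and>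
        (\<xi> \<in> {1 - C2 / C3 <..< C1 / C3} \<and> \<xi> = \<beta> \<longrightarrow>
          finite_time_stable_at {0..C1} (poincare1 C0 C1 C2 C3 \<beta> \<xi>) (\<xi> * C3)) \<and>
        (C3 = C0 \<and> \<xi> \<in> {1 - C2 / C3 <..< C1 / C3} \<and> \<xi> > \<beta> \<longrightarrow>
          finite_time_stable_at {0..C1} (poincare1 C0 C1 C2 C3 \<beta> \<xi>) (\<xi> * C3))) \<and>
     (\<xi> \<in> Xi2 C1 C2 C3 \<beta> \<and> \<xi> < 1 \<longrightarrow>
        (0 \<le> \<xi> \<and> \<xi> \<le> 1 - C2 / C3 \<longrightarrow>
          finite_time_stable_at {C3 - C2..C3} (poincare2 C0 C1 C2 C3 \<beta> \<xi>) (C3 - C2)) \<and>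
        (C3 = C0 \<and> \<xi> \<in> {1 - C2 / C3 <..< C1 / C3} \<and> \<xi> < \<beta> \<longrightarrow>
          finite_time_stable_at {C3 - C2..C3} (poincare2 C0 C1 C2 C3 \<beta> \<xi>) (\<xi> * C3)))"
proof (intro conjI impI; (elim conjE)?)
  assume "\<xi> > 0" "C1 / C3 \<le> \<xi>" "\<xi> \<le> 1"
  then show "finite_time_stable_at {0..C1} (poincare1 C0 C1 C2 C3 \<beta> \<xi>) C1"
    using assms by (intro finite_time_stable_at_two_steps) (auto simp: poincare1_eq_C1)
next
  assume "\<xi> > 0" and mid: "\<xi> \<in> {1 - C2 / C3 <..< C1 / C3}" and "\<xi> = \<beta>"
  have bounds: "C3 - C2 < \<xi> * C3" "\<xi> * C3 < C1"
    using mid assms(4) by (auto simp: field_simps)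
  \<comment> \<open>This bounds the first entry of \<open>A1\<close> by \<open>\<xi> * C3\<close>,
    which the entry \<open>\<beta> * C3\<close> attains.\<close>
  have "(1 - \<xi>) * C3 \<le> (1 - \<xi>) * C0"
    using assms(5,8) by (intro mult_left_mono) auto
  then have "A1 C0 C2 C3 \<beta> \<xi> = \<xi> * C3"
    using bounds \<open>\<xi> = \<beta>\<close> by (simp add: A1_def algebra_simps)
  then show "finite_time_stable_at {0..C1} (poincare1 C0 C1 C2 C3 \<beta> \<xi>) (\<xi> * C3)"
    using \<open>\<xi> > 0\<close> bounds assms(4,8) by (intro finite_time_stable_poincare1) auto
next
  assume "\<xi> > 0" "C3 = C0" and mid: "\<xi> \<in> {1 - C2 / C3 <..< C1 / C3}" and "\<xi> > \<beta>"
  have bounds: "C3 - C2 < \<xi> * C3" "\<xi> * C3 < C1"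
    using mid assms(4) by (auto simp: field_simps)
  \<comment> \<open>Now the first entry of \<open>A1\<close> attains the maximum: with
    \<open>C3 = C0\<close> it equals \<open>\<xi> * C3\<close>.\<close>
  have "\<beta> * C3 < \<xi> * C3"
    using \<open>\<xi> > \<beta>\<close> assms(4) by simp
  then have "A1 C0 C2 C3 \<beta> \<xi> = \<xi> * C3"
    using bounds \<open>C3 = C0\<close> by (simp add: A1_def algebra_simps)
  then show "finite_time_stable_at {0..C1} (poincare1 C0 C1 C2 C3 \<beta> \<xi>) (\<xi> * C3)"
    using \<open>\<xi> > 0\<close> bounds assms(4,8) by (intro finite_time_stable_poincare1) auto
next
  assume "\<xi> < 1" "0 \<le> \<xi>" "\<xi> \<le> 1 - C2 / C3"
  then show "finite_time_stable_at {C3 - C2..C3} (poincare2 C0 C1 C2 C3 \<beta> \<xi>) (C3 - C2)"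
    using assms by (intro finite_time_stable_at_two_steps) (auto simp: poincare2_eq_C3_minus_C2)
next
  assume "\<xi> < 1" "C3 = C0" and mid: "\<xi> \<in> {1 - C2 / C3 <..< C1 / C3}" and "\<xi> < \<beta>"
  have bounds: "C3 - C2 < \<xi> * C3" "\<xi> * C3 < C1"
    using mid assms(4) by (auto simp: field_simps)
  \<comment> \<open>With \<open>C3 = C0\<close> the entry \<open>\<xi> * C0\<close> is the minimum
    in \<open>A2'\<close>, as \<open>C1\<close> and \<open>\<beta> * C3\<close> both exceed
    it.\<close>
  have "\<xi> * C3 < \<beta> * C3"
    using \<open>\<xi> < \<beta>\<close> assms(4) by simp
  then have "A2' C0 C1 C3 \<beta> \<xi> = \<xi> * C3"
    using bounds \<open>C3 = C0\<close> by (simp add: A2'_def)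
  then show "finite_time_stable_at {C3 - C2..C3} (poincare2 C0 C1 C2 C3 \<beta> \<xi>) (\<xi> * C3)"
    using \<open>\<xi> < 1\<close> bounds assms(4,8) by (intro finite_time_stable_poincare2) auto
qed

end
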